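(* Let $X$ be a completely regular topological space. Fix $f,g\in C(X)$, $f\neq g$, and suppose that $f$ and $g$ have a non-zero rr-lower bound. Let $\{h_\alpha\}_{\alpha\in A}$ be the set of non-zero rr-lower bounds of $f$ and $g$, let $U_\alpha=\mathrm{coz}\, h_\alpha$ for $\alpha\in A$, and let $U=\bigcup_{\alpha\in A}U_\alpha$. (i) The infimum $f\wedge_{\mathrm{rr}} g$ exists if and only if $U$ has the property: if $x\in\mathbf{bd}\, U$ and $N$ is any neighbourhood of $x$ then, for some $\beta\in A$, $N\cap\mathbf{bd}\, U_\beta\neq\emptyset$. (ii) Moreover, $f\wedge_{\mathrm{rr}} g$ exists if and only if $U$ has the property: if $x\in\mathbf{bd}\, U$ then for each $\varepsilon>0$ there is a neighbourhood $N_\varepsilon$ of $x$ such that for all $\alpha\in A$, $N_\varepsilon\cap U_\alpha\subseteq\{y\in X\mid |h_\alpha(y)|<\varepsilon\}$.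
   Context: $C(X)$ is the ring of continuous real-valued functions on $X$. The reduced ring order (rr-order) on a reduced ring, in particular on $C(X)$, is the partial order $a\le_{\mathrm{rr}} b$ if and only if $ab=a^2$; an rr-lower bound of $f$ and $g$ is an $h$ with $h\le_{\mathrm{rr}} f$ and $h\le_{\mathrm{rr}} g$, and $f\wedge_{\mathrm{rr}} g$ denotes their infimum (greatest rr-lower bound) in $C(X)$. For $h\in C(X)$, $\mathrm{coz}\, h=\{x\in X\mid h(x)\neq 0\}$. For $Y\subseteq X$, $\mathbf{bd}\, Y=\overline{Y}\setminus Y$. Completely regular spaces are taken to be Hausdorff, as in Gillman–Jerison. *)

theory Defs
  imports "HOL-Analysis.Analysis" "HOL-Algebra.Ring"
begin

text \<open>The order is stated for an arbitrary ring; it is a partial order when the ring is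
  reduced (for the rings of continuous functions used here, see
  \<open>partial_order_rr_order_cont_ring\<close> below).\<close>

definition rr_order :: "('a, 'b) ring_scheme \<Rightarrow> 'a gorder" where
  "rr_order R = \<lparr>carrier = carrier R, eq = (=),
                 le = (\<lambda>a b. a \<otimes>\<^bsub>R\<^esub> b = a [^]\<^bsub>R\<^esub> (2::nat))\<rparr>"

text \<open>HOL functions are total, so elements of $C(X)$ are normalised to \<open>undefined\<close> outside
  \<open>topspace X\<close>; equality in the carrier is then equality of functions on the space.\<close>

definition cont_ring :: "'a topology \<Rightarrow> ('a \<Rightarrow> real) ring" where
  "cont_ring X =
     \<lparr>carrier = {f \<in> extensional (topspace X). continuous_map X euclideanreal f},
      mult = (\<lambda>f g. \<lambda>x\<in>topspace X. f x * g x),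
      one = (\<lambda>x\<in>topspace X. 1),
      zero = (\<lambda>x\<in>topspace X. 0),
      add = (\<lambda>f g. \<lambda>x\<in>topspace X. f x + g x)\<rparr>"

definition coz :: "'a topology \<Rightarrow> ('a \<Rightarrow> real) \<Rightarrow> 'a set" where
  "coz X h = {x \<in> topspace X. h x \<noteq> 0}"

text \<open>Not the library's \<open>frontier_of\<close>, which subtracts the interior; the two agree on open sets.\<close>

definition bd :: "'a topology \<Rightarrow> 'a set \<Rightarrow> 'a set" where
  "bd X Y = (X closure_of Y) - Y"

text \<open>Neighbourhoods need not be open.\<close>

definition is_nbhd :: "'a topology \<Rightarrow> 'a \<Rightarrow> 'a set \<Rightarrow> bool" where
  "is_nbhd X x N \<longleftrightarrow> N \<subseteq> topspace X \<and> x \<in> X interior_of N"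

lemma continuous_map_cont_ring_cong:
  "continuous_map X euclideanreal (\<lambda>x\<in>topspace X. f x) \<longleftrightarrow> continuous_map X euclideanreal f"
  by (metis (mono_tags, lifting) continuous_map_eq restrict_apply')

lemma cring_cont_ring: "cring (cont_ring X)"
proof (intro cringI abelian_groupI comm_monoidI)
  fix f assume f: "f \<in> carrier (cont_ring X)"
  have "(\<lambda>x\<in>topspace X. - f x) \<in> carrier (cont_ring X)"
    using f by (auto simp: cont_ring_def continuous_map_cont_ring_cong intro: continuous_map_minus)
  moreover have "(\<lambda>x\<in>topspace X. - f x) \<oplus>\<^bsub>cont_ring X\<^esub> f = \<zero>\<^bsub>cont_ring X\<^esub>"
    by (auto simp: cont_ring_def fun_eq_iff)
  ultimately show "\<exists>g\<in>carrier (cont_ring X). g \<oplus>\<^bsub>cont_ring X\<^esub> f = \<zero>\<^bsub>cont_ring X\<^esub>"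
    by blast
qed (auto simp: cont_ring_def continuous_map_cont_ring_cong fun_eq_iff extensional_def algebra_simps
       intro: continuous_map_add continuous_map_real_mult)

lemma rr_le_cont_ring_iff:
  assumes "a \<in> carrier (cont_ring X)"
  shows "le (rr_order (cont_ring X)) a b \<longleftrightarrow> (\<forall>x\<in>topspace X. a x = 0 \<or> a x = b x)"
proof -
  interpret cring "cont_ring X" by (rule cring_cont_ring)
  have "a [^]\<^bsub>cont_ring X\<^esub> (2::nat) = a \<otimes>\<^bsub>cont_ring X\<^esub> a"
    using assms by (simp add: numeral_2_eq_2)
  then show ?thesis
    by (auto simp: rr_order_def cont_ring_def fun_eq_iff restrict_def)
qed

lemma partial_order_rr_order_cont_ring: "partial_order (rr_order (cont_ring X))"
proof -
  let ?L = "rr_order (cont_ring X)"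
  have carr: "carrier ?L = carrier (cont_ring X)" and eq: "eq ?L = (=)"
    by (simp_all add: rr_order_def)
  have anti: "a = b"
    if "le ?L a b" "le ?L b a" "a \<in> carrier (cont_ring X)" "b \<in> carrier (cont_ring X)" for a b
  proof (rule extensionalityI[where A = "topspace X"])
    show "a x = b x" if "x \<in> topspace X" for x
      using \<open>le ?L a b\<close> \<open>le ?L b a\<close> that \<open>a \<in> _\<close> \<open>b \<in> _\<close> by (metis rr_le_cont_ring_iff)
  qed (use that in \<open>auto simp: cont_ring_def\<close>)
  have trans: "le ?L a c"
    if "le ?L a b" "le ?L b c" "a \<in> carrier (cont_ring X)" "b \<in> carrier (cont_ring X)" for a b c
    using that by (metis rr_le_cont_ring_iff)
  show ?thesis
  proof unfold_locales
    fix a b c assume "le ?L a b" "le ?L b c" "a \<in> carrier ?L" "b \<in> carrier ?L"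
    then show "le ?L a c" by (simp only: carr) (rule trans)
  qed (auto simp: carr eq rr_le_cont_ring_iff intro: anti)
qed

end

theory Submission
  imports Defs
begin

text \<open>A lower bound \<open>k\<close> of \<open>f\<close> and \<open>g\<close> agrees with both on \<open>coz k\<close>, so by continuity \<open>f\<close>
  vanishes on \<open>bd (coz k)\<close>. An infimum must agree with \<open>f\<close> on \<open>U\<close> and vanish elsewhere, and this
  function is continuous precisely when \<open>f\<close> vanishes on \<open>bd U\<close>. Both properties of \<open>U\<close> express
  this vanishing.\<close>

lemma carrier_cont_ring_iff:
  "k \<in> carrier (cont_ring X) \<longleftrightarrow> k \<in> extensional (topspace X) \<and> continuous_map X euclideanreal k"
  by (simp add: cont_ring_def)

text \<open>In the reals \<open>a * b = a * a\<close> forces \<open>a = 0\<close> or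
  \<open>a = b\<close>, so the order becomes a dichotomy at each point.\<close>

lemma Lower_rr_cont_ring_iff:
  assumes "f \<in> carrier (cont_ring X)" "g \<in> carrier (cont_ring X)"
  shows "k \<in> Lower (rr_order (cont_ring X)) {f, g} \<longleftrightarrow>
    k \<in> carrier (cont_ring X) \<and> (\<forall>x\<in>topspace X. k x = 0 \<or> k x = f x \<and> k x = g x)"
proof -
  have "k \<in> Lower (rr_order (cont_ring X)) {f, g} \<longleftrightarrow>
    k \<in> carrier (cont_ring X) \<and> le (rr_order (cont_ring X)) k f \<and> le (rr_order (cont_ring X)) k g"
    using assms by (auto simp: Lower_def rr_order_def)
  then show ?thesis
    by (metis rr_le_cont_ring_iff)
qed

text \<open>Members of the carrier are \<open>undefined\<close> off the space, so vanishing on the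
  space determines them. This turns a non-zero lower bound into a non-empty cozero set.\<close>

lemma coz_eq_empty_iff:
  assumes "k \<in> carrier (cont_ring X)"
  shows "coz X k = {} \<longleftrightarrow> k = \<zero>\<^bsub>cont_ring X\<^esub>"
proof
  assume "coz X k = {}"
  then show "k = \<zero>\<^bsub>cont_ring X\<^esub>"
    using assms by (intro extensionalityI[where A = "topspace X"]) (auto simp: cont_ring_def coz_def)
qed (auto simp: coz_def cont_ring_def)

lemma openin_coz:
  assumes "continuous_map X euclideanreal k"
  shows "openin X (coz X k)"
proof -
  have "openin X {x \<in> topspace X. k x \<in> - {0}}"
    using assms by (rule openin_continuous_map_preimage) (simp add: open_Compl)
  then show ?thesis
    by (simp add: coz_def)
qed

lemma openin_is_nbhd:
  assumes "openin X N" "x \<in> N"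
  shows "is_nbhd X x N"
  using assms by (simp add: is_nbhd_def interior_of_openin openin_subset)

lemma bd_subset_topspace: "x \<in> bd X Y \<Longrightarrow> x \<in> topspace X"
  by (auto simp: bd_def in_closure_of)

lemma is_nbhd_meets_closure:
  assumes "x \<in> X closure_of S" "is_nbhd X x N"
  shows "N \<inter> S \<noteq> {}"
proof -
  have "\<exists>y\<in>S. y \<in> X interior_of N"
    using assms by (auto simp: in_closure_of is_nbhd_def)
  then show ?thesis
    using interior_of_subset[of X N] by auto
qed

text \<open>Continuous real functions that agree on a set agree on its closure, because the reals
  are Hausdorff. Here \<open>k\<close> and \<open>f\<close> agree on \<open>coz X k\<close>, and
  \<open>k\<close> is zero at points of the closure outside that set.\<close>

lemma eq_zero_on_bd_coz:
  assumes "continuous_map X euclideanreal k" "continuous_map X euclideanreal f"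
    and "\<And>x. x \<in> topspace X \<Longrightarrow> k x = 0 \<or> k x = f x"
    and "x \<in> bd X (coz X k)"
  shows "f x = 0"
proof -
  have "x \<in> X closure_of coz X k" and "k x = 0"
    using assms(4) bd_subset_topspace[OF assms(4)] by (auto simp: bd_def coz_def)
  moreover have "k y = f y" if "y \<in> coz X k" for y
    using that assms(3) by (auto simp: coz_def)
  ultimately show ?thesis
    using forall_in_closure_of_eq[of x X "coz X k" euclideanreal k f] assms(1,2)
    by simp
qed

text \<open>Pasting on the closures of \<open>U\<close> and of its complement: these meet in the
  frontier, which for open \<open>U\<close> is \<open>bd X U\<close>, and there both pieces are
  zero.\<close>

lemma continuous_map_zero_extension:
  fixes f :: "'a \<Rightarrow> real"
  assumes "continuous_map X euclideanreal f" "openin X U" "\<And>x. x \<in> bd X U \<Longrightarrow> f x = 0"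
  shows "continuous_map X euclideanreal (\<lambda>x. if x \<in> U then f x else 0)"
proof (rule continuous_map_cases)
  show "continuous_map (subtopology X (X closure_of {x. x \<in> U})) euclideanreal f"
    using assms(1) by (rule continuous_map_from_subtopology)
  show "f x = 0" if "x \<in> X frontier_of {x. x \<in> U}" for x
    using that assms(2,3) by (simp add: frontier_of_def bd_def interior_of_openin)
qed simp

text \<open>Proved as a cycle: an infimum makes \<open>U\<close> a single cozero set of the family,
  then \<open>f\<close> vanishes on \<open>bd X U\<close>, and then an infimum exists. The middle
  condition is recorded because it supplies the one index that the first property of the theorem
  asks for.\<close>

lemma
  assumes f: "f \<in> carrier (cont_ring X)" and g: "g \<in> carrier (cont_ring X)"
    and nz: "\<exists>k \<in> Lower (rr_order (cont_ring X)) {f, g}. k \<noteq> \<zero>\<^bsub>cont_ring X\<^esub>"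
    and h: "h ` A = {k \<in> Lower (rr_order (cont_ring X)) {f, g}. k \<noteq> \<zero>\<^bsub>cont_ring X\<^esub>}"
    and U: "U = (\<Union>\<alpha>\<in>A. coz X (h \<alpha>))"
  shows ex_glb_iff_eq_zero_on_bd: "(\<exists>m. is_glb (rr_order (cont_ring X)) m {f, g}) \<longleftrightarrow> (\<forall>x\<in>bd X U. f x = 0)"
    and ex_glb_iff_eq_coz: "(\<exists>m. is_glb (rr_order (cont_ring X)) m {f, g}) \<longleftrightarrow> (\<exists>\<beta>\<in>A. U = coz X (h \<beta>))"
proof -
  let ?C = "carrier (cont_ring X)" and ?L = "rr_order (cont_ring X)"
  note low = Lower_rr_cont_ring_iff[OF f g]
  have hA: "h \<alpha> \<in> Lower ?L {f, g}" if "\<alpha> \<in> A" for \<alpha>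
    using h that by blast
  have hC: "h \<alpha> \<in> ?C" if "\<alpha> \<in> A" for \<alpha>
    using hA[OF that] low by blast
  have hval: "h \<alpha> x = 0 \<or> h \<alpha> x = f x \<and> h \<alpha> x = g x" if "\<alpha> \<in> A" "x \<in> topspace X" for \<alpha> x
    using hA[OF that(1)] low that(2) by blast
  have hcont: "continuous_map X euclideanreal (h \<alpha>)" if "\<alpha> \<in> A" for \<alpha>
    using hC[OF that] by (simp add: carrier_cont_ring_iff)
  have fcont: "continuous_map X euclideanreal f"
    using f by (simp add: carrier_cont_ring_iff)
  have Uopen: "openin X U"
    unfolding U using hcont openin_coz by blast
  have cozU: "coz X k \<subseteq> U" if "k \<in> Lower ?L {f, g}" for k
  \<comment> \<open>The family omits the zero function, whose cozero set is empty.\<close>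
  proof (cases "k = \<zero>\<^bsub>cont_ring X\<^esub>")
    case True
    then show ?thesis
      by (simp add: coz_def cont_ring_def)
  next
    case False
    with that h have "k \<in> h ` A" by blast
    then show ?thesis
      unfolding U by blast
  qed
  have greatest_iff: "is_glb ?L m {f, g} \<longleftrightarrow>
      m \<in> Lower ?L {f, g} \<and> (\<forall>k\<in>Lower ?L {f, g}. le ?L k m)" for m
    by (auto simp: greatest_def Lower_def)
  have 1: "\<exists>\<beta>\<in>A. U = coz X (h \<beta>)" if "is_glb ?L m {f, g}" for m
  proof -
    have m: "m \<in> Lower ?L {f, g}"
      using that unfolding greatest_iff by blast
    have le: "le ?L k m" if "k \<in> Lower ?L {f, g}" for k
      using that \<open>is_glb ?L m {f, g}\<close> unfolding greatest_iff by blast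
    \<comment> \<open>Wherever \<open>k\<close> is non-zero, \<open>m\<close> has the same value as
      \<open>k\<close>.\<close>
    have sub: "coz X k \<subseteq> coz X m" if "k \<in> Lower ?L {f, g}" for k
    proof -
      have "k \<in> ?C"
        using that low by blast
      then show ?thesis
        using le[OF that] by (auto simp: rr_le_cont_ring_iff coz_def)
    qed
    \<comment> \<open>The non-zero lower bound given by \<open>nz\<close> has a non-empty cozero
      set, contained in that of \<open>m\<close>. Hence \<open>m\<close> belongs to the
      family.\<close>
    have "m \<noteq> \<zero>\<^bsub>cont_ring X\<^esub>"
      using nz sub low coz_eq_empty_iff m by (metis subset_empty)
    with m have "m \<in> h ` A"
      unfolding h by blast
    then obtain \<beta> where "\<beta> \<in> A" "m = h \<beta>"
      by blast
    moreover have "U \<subseteq> coz X m"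
      using sub hA unfolding U by blast
    ultimately show ?thesis
      using cozU[OF m] by blast
  qed
  have 2: "\<forall>x\<in>bd X U. f x = 0" if ex: "\<exists>\<beta>\<in>A. U = coz X (h \<beta>)"
  proof -
    obtain \<beta> where \<beta>: "\<beta> \<in> A" "U = coz X (h \<beta>)"
      using ex by blast
    have "h \<beta> x = 0 \<or> h \<beta> x = f x" if "x \<in> topspace X" for x
      using hval[OF \<beta>(1) that] by blast
    then show ?thesis
      using eq_zero_on_bd_coz[OF hcont[OF \<beta>(1)] fcont] \<beta>(2) by blast
  qed
  have 3: "\<exists>m. is_glb ?L m {f, g}" if zero: "\<forall>x\<in>bd X U. f x = 0"
  proof -
    let ?m = "\<lambda>x\<in>topspace X. if x \<in> U then f x else 0"
    \<comment> \<open>A point of \<open>U\<close> lies in the cozero set of some lower bound, whose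
      value there is both \<open>f x\<close> and \<open>g x\<close>. So \<open>?m\<close> lies below
      \<open>g\<close> as well as \<open>f\<close>.\<close>
    have "f x = g x" if "x \<in> U" for x
    proof -
      obtain \<alpha> where "\<alpha> \<in> A" "x \<in> topspace X" "h \<alpha> x \<noteq> 0"
        using \<open>x \<in> U\<close> by (auto simp: U coz_def)
      then show ?thesis
        using hval[of \<alpha> x] by simp
    qed
    then have "?m \<in> Lower ?L {f, g}"
      using continuous_map_zero_extension[OF fcont Uopen] zero
      by (simp add: low carrier_cont_ring_iff continuous_map_cont_ring_cong)
    moreover have "le ?L k ?m" if "k \<in> Lower ?L {f, g}" for k
    proof -
      have "k x = 0 \<or> k x = f x \<and> k x = g x" if "x \<in> topspace X" for x
        using low \<open>k \<in> Lower ?L {f, g}\<close> that by blast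
      moreover have "k x = 0 \<or> x \<in> U" if "x \<in> topspace X" for x
        using cozU[OF \<open>k \<in> Lower ?L {f, g}\<close>] that by (auto simp: coz_def)
      ultimately have "\<forall>x\<in>topspace X. k x = 0 \<or> k x = ?m x"
        by auto
      moreover have "k \<in> ?C"
        using low \<open>k \<in> Lower ?L {f, g}\<close> by blast
      ultimately show ?thesis
        using rr_le_cont_ring_iff by blast
    qed
    ultimately show ?thesis
      unfolding greatest_iff by blast
  qed
  show "(\<exists>m. is_glb ?L m {f, g}) \<longleftrightarrow> (\<forall>x\<in>bd X U. f x = 0)"
    and "(\<exists>m. is_glb ?L m {f, g}) \<longleftrightarrow> (\<exists>\<beta>\<in>A. U = coz X (h \<beta>))"
    using 1 2 3 by blast+
qed

theorem theorem3p2: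
  fixes X :: "'a topology"
    and f g :: "'a \<Rightarrow> real"
    and A :: "'i set"
    and h :: "'i \<Rightarrow> 'a \<Rightarrow> real"
    and U :: "'a set"
  assumes "completely_regular_space X" and "Hausdorff_space X"
    and "f \<in> carrier (cont_ring X)" and "g \<in> carrier (cont_ring X)" and "f \<noteq> g"
    and "\<exists>k \<in> Lower (rr_order (cont_ring X)) {f, g}. k \<noteq> \<zero>\<^bsub>cont_ring X\<^esub>"
    and "h ` A = {k \<in> Lower (rr_order (cont_ring X)) {f, g}. k \<noteq> \<zero>\<^bsub>cont_ring X\<^esub>}"
    and "U = (\<Union>\<alpha>\<in>A. coz X (h \<alpha>))"
  shows "((\<exists>m. is_glb (rr_order (cont_ring X)) m {f, g}) \<longleftrightarrow>
           (\<forall>x\<in>bd X U. \<forall>N. is_nbhd X x N \<longrightarrow> (\<exists>\<beta>\<in>A. N \<inter> bd X (coz X (h \<beta>)) \<noteq> {})))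
       \<and> ((\<exists>m. is_glb (rr_order (cont_ring X)) m {f, g}) \<longleftrightarrow>
           (\<forall>x\<in>bd X U. \<forall>\<epsilon>>0. \<exists>N. is_nbhd X x N \<and>
              (\<forall>\<alpha>\<in>A. N \<inter> coz X (h \<alpha>) \<subseteq> {y \<in> topspace X. \<bar>h \<alpha> y\<bar> < \<epsilon>})))"
proof -
  let ?L = "rr_order (cont_ring X)"
  note glb_zero = ex_glb_iff_eq_zero_on_bd[OF assms(3,4,6-8)] and glb_coz = ex_glb_iff_eq_coz[OF assms(3,4,6-8)]
  have fcont: "continuous_map X euclideanreal f"
    using assms(3) by (simp add: carrier_cont_ring_iff)
  have hcont: "continuous_map X euclideanreal (h \<alpha>)"
    and hval: "\<And>x. x \<in> topspace X \<Longrightarrow> h \<alpha> x = 0 \<or> h \<alpha> x = f x" if "\<alpha> \<in> A" for \<alpha>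
  proof -
    have "h \<alpha> \<in> Lower ?L {f, g}"
      using assms(7) that by blast
    then have "h \<alpha> \<in> carrier (cont_ring X)"
      and "\<forall>x\<in>topspace X. h \<alpha> x = 0 \<or> h \<alpha> x = f x \<and> h \<alpha> x = g x"
      by (simp_all add: Lower_rr_cont_ring_iff[OF assms(3,4)])
    then show "continuous_map X euclideanreal (h \<alpha>)"
      and "\<And>x. x \<in> topspace X \<Longrightarrow> h \<alpha> x = 0 \<or> h \<alpha> x = f x"
      by (auto simp: carrier_cont_ring_iff)
  qed
  have zero_iff_meets: "(\<forall>x\<in>bd X U. f x = 0) \<longleftrightarrow>
      (\<forall>x\<in>bd X U. \<forall>N. is_nbhd X x N \<longrightarrow> (\<exists>\<beta>\<in>A. N \<inter> bd X (coz X (h \<beta>)) \<noteq> {}))"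
    (is "_ \<longleftrightarrow> ?meets")
  proof
    assume "\<forall>x\<in>bd X U. f x = 0"
    \<comment> \<open>Going through the infimum gives one index whose cozero set is all of
      \<open>U\<close>; then \<open>x\<close> itself is the required point of
      \<open>N\<close>.\<close>
    then obtain \<beta> where "\<beta> \<in> A" "U = coz X (h \<beta>)"
      using glb_zero glb_coz by auto
    moreover have "x \<in> N" if "is_nbhd X x N" for x N
      using that interior_of_subset by (fastforce simp: is_nbhd_def)
    ultimately show ?meets by auto
  next
    assume meets: ?meets
    show "\<forall>x\<in>bd X U. f x = 0"
    proof (rule ballI, rule ccontr)
      fix x assume x: "x \<in> bd X U" and "f x \<noteq> 0"
      \<comment> \<open>Test the property on the set where \<open>f\<close> is non-zero: it can
        contain no boundary point of any \<open>coz X (h \<beta>)\<close>, since \<open>f\<close>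
        vanishes at such points.\<close>
      then have "is_nbhd X x (coz X f)"
        using openin_coz[OF fcont] bd_subset_topspace by (intro openin_is_nbhd) (auto simp: coz_def)
      then obtain \<beta> y where "\<beta> \<in> A" "y \<in> coz X f" "y \<in> bd X (coz X (h \<beta>))"
        using meets x by blast
      then show False
        using eq_zero_on_bd_coz[OF hcont fcont hval, of \<beta>] by (auto simp: coz_def)
    qed
  qed
  have zero_iff_small: "(\<forall>x\<in>bd X U. f x = 0) \<longleftrightarrow>
      (\<forall>x\<in>bd X U. \<forall>\<epsilon>>0. \<exists>N. is_nbhd X x N \<and>
        (\<forall>\<alpha>\<in>A. N \<inter> coz X (h \<alpha>) \<subseteq> {y \<in> topspace X. \<bar>h \<alpha> y\<bar> < \<epsilon>}))"
    (is "_ \<longleftrightarrow> ?small")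
  proof
    assume zero: "\<forall>x\<in>bd X U. f x = 0"
    show ?small
    proof (intro ballI allI impI)
      fix x \<epsilon> assume x: "x \<in> bd X U" and "\<epsilon> > (0::real)"
      \<comment> \<open>Chosen from \<open>f\<close> alone, this set serves all indices at once,
        because every \<open>h \<alpha>\<close> equals \<open>f\<close> on its cozero set.\<close>
      let ?N = "{y \<in> topspace X. f y \<in> {-\<epsilon><..<\<epsilon>}}"
      have "openin X ?N"
        using fcont by (rule openin_continuous_map_preimage) simp
      then have "is_nbhd X x ?N"
        using x zero \<open>\<epsilon> > 0\<close> bd_subset_topspace by (intro openin_is_nbhd) auto
      moreover have "?N \<inter> coz X (h \<alpha>) \<subseteq> {y \<in> topspace X. \<bar>h \<alpha> y\<bar> < \<epsilon>}" if "\<alpha> \<in> A" for \<alpha>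
      proof
        fix y assume y: "y \<in> ?N \<inter> coz X (h \<alpha>)"
        then have "h \<alpha> y = f y"
          using hval[OF that] by (auto simp: coz_def)
        then show "y \<in> {y \<in> topspace X. \<bar>h \<alpha> y\<bar> < \<epsilon>}"
          using y by (auto simp: abs_less_iff)
      qed
      ultimately show "\<exists>N. is_nbhd X x N \<and>
          (\<forall>\<alpha>\<in>A. N \<inter> coz X (h \<alpha>) \<subseteq> {y \<in> topspace X. \<bar>h \<alpha> y\<bar> < \<epsilon>})"
        by blast
    qed
  next
    assume small: ?small
    show "\<forall>x\<in>bd X U. f x = 0"
    proof (rule ballI, rule ccontr)
      fix x assume x: "x \<in> bd X U" and "f x \<noteq> 0"
      \<comment> \<open>Any value strictly between 0 and \<open>\<bar>f x\<bar>\<close> would do: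
        \<open>x\<close> then lies in the open set \<open>?V\<close>, on which each non-zero value
        of an \<open>h \<alpha>\<close> exceeds \<open>\<epsilon>\<close> in modulus.\<close>
      define \<epsilon> where "\<epsilon> = \<bar>f x\<bar> / 2"
      have \<epsilon>: "0 < \<epsilon>" "\<epsilon> < \<bar>f x\<bar>"
        using \<open>f x \<noteq> 0\<close> by (simp_all add: \<epsilon>_def)
      obtain N where N: "is_nbhd X x N"
        and bound: "\<And>\<alpha>. \<alpha> \<in> A \<Longrightarrow> N \<inter> coz X (h \<alpha>) \<subseteq> {y \<in> topspace X. \<bar>h \<alpha> y\<bar> < \<epsilon>}"
        using small x \<epsilon>(1) by blast
      let ?V = "{y \<in> topspace X. \<bar>f y\<bar> \<in> {\<epsilon><..}}"
      have "openin X ?V"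
        by (rule openin_continuous_map_preimage[of X euclideanreal]) (use fcont in \<open>auto intro: continuous_map_real_abs\<close>)
      \<comment> \<open>\<open>N\<close> need not be open, so its interior is used. As
        \<open>x\<close> is in the closure of \<open>U\<close>, this open set meets some
        \<open>coz X (h \<alpha>)\<close>, where the bound on \<open>N\<close> contradicts the one
        on \<open>?V\<close>.\<close>
      then have "openin X (X interior_of N \<inter> ?V)"
        by (simp add: openin_Int)
      then have "is_nbhd X x (X interior_of N \<inter> ?V)"
        using N \<epsilon>(2) bd_subset_topspace[OF x] by (intro openin_is_nbhd) (auto simp: is_nbhd_def)
      moreover have "x \<in> X closure_of U"
        using x by (simp add: bd_def)
      ultimately have "X interior_of N \<inter> ?V \<inter> U \<noteq> {}"
        by (intro is_nbhd_meets_closure)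
      then obtain y where y: "y \<in> X interior_of N \<inter> ?V" "y \<in> U"
        by auto
      then obtain \<alpha> where \<alpha>: "\<alpha> \<in> A" "y \<in> coz X (h \<alpha>)"
        unfolding assms(8) by blast
      have "y \<in> N"
        using y(1) interior_of_subset by fastforce
      then have "\<bar>h \<alpha> y\<bar> < \<epsilon>"
        using bound[OF \<alpha>(1)] \<alpha>(2) by blast
      moreover have "h \<alpha> y = f y"
        using hval[OF \<alpha>(1)] \<alpha>(2) by (auto simp: coz_def)
      ultimately show False
        using y(1) by simp
    qed
  qed
  show ?thesis
    using glb_zero zero_iff_meets zero_iff_small by simp
qed

end
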